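(* Let $D\ge 3$. For the folded cube $\square_{2D+1}$, the Terwilliger algebra $T$ with respect to $\mathbf 0$ coincides with the linear span $\mathcal A'$ of the matrices $M^t_{i,j}$, $(i,j,t)\in\mathcal I'$; moreover these matrices form a basis of $\mathcal A'$.
   Context: Let $S=\{1,\dots,2D+1\}$, $X$ the set of unordered pairs $\{u,u'\}$ of subsets of $S$ with $u\cap u'=\emptyset$, $u\cup u'=S$. The folded cube $\square_{2D+1}$ is the graph on $X$ with distance $\partial(x,y)=\min\{|x_1\triangle y_1|,|x_1\triangle y_2|\}$ for $x=\{x_1,x_2\},y=\{y_1,y_2\}$ (adjacent iff distance $1$); its diameter is $D$. Let $\mathbf 0=\{\emptyset,S\}$. Write each vertex as $x=(x_1,x_2)$ with $|x_1|<|x_2|$. Let $\mathcal I'=\{(i,j,t):0\le t\le i,j\le D,\ i+j-t\le 2D\}$. For $(i,j,t)\in\mathcal I'$, $M^t_{i,j}$ is the $X\times X$ matrix with $(x,y)$-entry $1$ if $|x_1|=i$, $|y_1|=j$, $|x_1\cap y_1|=t$, and $0$ otherwise. For $0\le k\le D$, $A_k$ is the distance-$k$ matrix and $E^*_k$ the diagonal matrix with $(y,y)$-entry $1$ iff $\partial(\mathbf 0,y)=k$. The Terwilliger algebra $T$ with respect to $\mathbf 0$ is the subalgebra of $\mathrm{Mat}_X(\mathbb C)$ generated by $A_0,\dots,A_D,E^*_0,\dots,E^*_D$. *)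

theory Defs
  imports Complex_Main "HOL-Library.Function_Algebras"
begin

type_synonym vertex = "nat set set"

definition ground :: "nat \<Rightarrow> nat set" where
  "ground D = {1..2 * D + 1}"

definition vertices :: "nat \<Rightarrow> vertex set" where
  "vertices D = {{u, u'} | u u'. u \<subseteq> ground D \<and> u' \<subseteq> ground D \<and> u \<inter> u' = {} \<and> u \<union> u' = ground D}"

text \<open>For a vertex \<open>x\<close>, the two parts have different sizes since the ground set has odd
  size, so \<open>small x\<close> and \<open>large x\<close> are the parts \<open>x\<^sub>1\<close>, \<open>x\<^sub>2\<close> in the ordering
  with \<open>|x\<^sub>1| < |x\<^sub>2|\<close>.\<close>

definition small :: "vertex \<Rightarrow> nat set" where
  "small x = (THE u. \<exists>u'. x = {u, u'} \<and> card u < card u')"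

definition large :: "vertex \<Rightarrow> nat set" where
  "large x = (THE u'. \<exists>u. x = {u, u'} \<and> card u < card u')"

text \<open>On vertices the value does not depend on how the parts are labelled, see
  \<open>fc_dist_eq\<close> below.\<close>

definition fc_dist :: "vertex \<Rightarrow> vertex \<Rightarrow> nat" where
  "fc_dist x y = min (card (sym_diff (small x) (small y))) (card (sym_diff (small x) (large y)))"

definition base_vertex :: "nat \<Rightarrow> vertex" where
  "base_vertex D = {{}, ground D}"

lemma small_large_eq:
  assumes "card u < card u'"
  shows "small {u, u'} = u" "large {u, u'} = u'" "small {u', u} = u" "large {u', u} = u'"
proof -
  have *: "{u, u'} = {v, v'} \<and> card v < card v' \<longleftrightarrow> v = u \<and> v' = u'" for v v'
    using assms by (auto simp: doubleton_eq_iff)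
  show "small {u, u'} = u" "large {u, u'} = u'"
    by (simp_all add: small_def large_def *)
  then show "small {u', u} = u" "large {u', u} = u'"
    by (simp_all add: insert_commute)
qed

lemma vertices_pair:
  assumes "{u, u'} \<in> vertices D"
  shows "u \<subseteq> ground D" "u' = ground D - u" "card u < card u' \<or> card u' < card u"
proof -
  have "u \<subseteq> ground D \<and> u' \<subseteq> ground D \<and> u \<inter> u' = {} \<and> u \<union> u' = ground D"
    using assms by (auto simp: vertices_def doubleton_eq_iff)
  then show 1: "u \<subseteq> ground D" and 2: "u' = ground D - u" by auto
  have fin: "finite (ground D)" "finite u"
    using 1 by (auto simp: ground_def intro: finite_subset)
  have "card u \<le> card (ground D)" using 1 fin by (intro card_mono) auto
  moreover have "card u' = card (ground D) - card u"
    using 1 2 fin by (simp add: card_Diff_subset)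
  moreover have "card (ground D) = 2 * D + 1" by (simp add: ground_def)
  ultimately show "card u < card u' \<or> card u' < card u" by presburger
qed

lemma fc_dist_eq:
  assumes "{x1, x2} \<in> vertices D" and "{y1, y2} \<in> vertices D"
  shows "fc_dist {x1, x2} {y1, y2} = min (card (sym_diff x1 y1)) (card (sym_diff x1 y2))"
proof -
  note x = vertices_pair[OF assms(1)] and y = vertices_pair[OF assms(2)]
  have "sym_diff x2 y1 = sym_diff x1 y2" and "sym_diff x2 y2 = sym_diff x1 y1"
    using x(1,2) y(1,2) by auto
  with x(3) y(3) show ?thesis
    by (elim disjE) (simp_all only: fc_dist_def small_large_eq min.commute)
qed

text \<open>A matrix with rows and columns indexed by the vertices is represented by a function that
  is zero outside the index set. Addition and zero are pointwise (from \<open>Function_Algebras\<close>); the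
  pointwise product of that theory is not used.\<close>

type_synonym matrix = "vertex \<Rightarrow> vertex \<Rightarrow> complex"

definition matrices :: "nat \<Rightarrow> matrix set" where
  "matrices D = {P. \<forall>x y. P x y \<noteq> 0 \<longrightarrow> x \<in> vertices D \<and> y \<in> vertices D}"

definition mat_scale :: "complex \<Rightarrow> matrix \<Rightarrow> matrix" where
  "mat_scale c P = (\<lambda>x y. c * P x y)"

definition mat_mult :: "nat \<Rightarrow> matrix \<Rightarrow> matrix \<Rightarrow> matrix" where
  "mat_mult D P Q = (\<lambda>x y. \<Sum>z\<in>vertices D. P x z * Q z y)"

definition mat_one :: "nat \<Rightarrow> matrix" where
  "mat_one D = (\<lambda>x y. if x \<in> vertices D \<and> y = x then 1 else 0)"

global_interpretation mat_vs: vector_space mat_scale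
  by unfold_locales (simp_all add: mat_scale_def fun_eq_iff algebra_simps)

definition subalgebra :: "nat \<Rightarrow> matrix set \<Rightarrow> bool" where
  "subalgebra D B \<longleftrightarrow> B \<subseteq> matrices D \<and> mat_vs.subspace B \<and> mat_one D \<in> B \<and>
    (\<forall>P\<in>B. \<forall>Q\<in>B. mat_mult D P Q \<in> B)"

lemma subalgebra_matrices: "subalgebra D (matrices D)"
proof -
  have "mat_mult D P Q \<in> matrices D" if "P \<in> matrices D" "Q \<in> matrices D" for P Q
    using that by (auto simp: matrices_def mat_mult_def elim!: sum.not_neutral_contains_not_neutral)
  moreover have "mat_vs.subspace (matrices D)"
    unfolding mat_vs.subspace_def
    by (simp add: matrices_def mat_scale_def) (metis add.right_neutral)
  moreover have "mat_one D \<in> matrices D"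
    by (auto simp: matrices_def mat_one_def)
  ultimately show ?thesis by (simp add: subalgebra_def)
qed

definition dist_mat :: "nat \<Rightarrow> nat \<Rightarrow> matrix" where
  "dist_mat D k = (\<lambda>x y. if x \<in> vertices D \<and> y \<in> vertices D \<and> fc_dist x y = k then 1 else 0)"

definition dual_idem :: "nat \<Rightarrow> nat \<Rightarrow> matrix" where
  "dual_idem D k =
    (\<lambda>x y. if x \<in> vertices D \<and> y = x \<and> fc_dist (base_vertex D) y = k then 1 else 0)"

definition terwilliger_algebra :: "nat \<Rightarrow> matrix set" where
  "terwilliger_algebra D = subalgebra D hull (dist_mat D ` {0..D} \<union> dual_idem D ` {0..D})"

definition index_set :: "nat \<Rightarrow> (nat \<times> nat \<times> nat) set" where
  "index_set D = {(i, j, t). t \<le> i \<and> t \<le> j \<and> i \<le> D \<and> j \<le> D \<and> i + j - t \<le> 2 * D}"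

definition M_mat :: "nat \<Rightarrow> nat \<times> nat \<times> nat \<Rightarrow> matrix" where
  "M_mat D = (\<lambda>(i, j, t) x y. if x \<in> vertices D \<and> y \<in> vertices D \<and>
     card (small x) = i \<and> card (small y) = j \<and> card (small x \<inter> small y) = t then 1 else 0)"

definition A_prime :: "nat \<Rightarrow> matrix set" where
  "A_prime D = mat_vs.span (M_mat D ` index_set D)"

text \<open>The family \<open>f\<close> indexed by \<open>I\<close> is a basis of \<open>V\<close>; in particular its members are
  pairwise distinct.\<close>

definition basis_family :: "('i \<Rightarrow> matrix) \<Rightarrow> 'i set \<Rightarrow> matrix set \<Rightarrow> bool" where
  "basis_family f I V \<longleftrightarrow> inj_on f I \<and> mat_vs.independent (f ` I) \<and> mat_vs.span (f ` I) = V"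

end

theory Submission
  imports Defs
begin

text \<open>The symmetric group of the ground set acts on the vertices, and its orbits on pairs of
  vertices are the sets of pairs \<open>(x, y)\<close> with prescribed \<open>|x\<^sub>1|\<close>, \<open>|y\<^sub>1|\<close>, \<open>|x\<^sub>1 \<inter> y\<^sub>1|\<close>.
  Hence \<open>\<A>'\<close> is the algebra of matrices constant on these orbits, which contains the generators
  of \<open>T\<close>. Conversely, \<open>M\<^sup>t\<^sub>i\<^sub>j = E\<^sup>*\<^sub>i A\<^sub>k E\<^sup>*\<^sub>j\<close> where \<open>k\<close> is the smaller of \<open>i + j - 2t\<close> and
  \<open>2D + 1 - (i + j - 2t)\<close>: these two numbers have different parity, so \<open>i\<close>, \<open>j\<close> and \<open>k\<close>
  determine \<open>t\<close>.\<close>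

section \<open>Vertices and their smaller parts\<close>

lemma finite_ground [simp]: "finite (ground D)"
  by (simp add: ground_def)

lemma card_ground [simp]: "card (ground D) = 2 * D + 1"
  by (simp add: ground_def)

lemma finite_vertices [simp]: "finite (vertices D)"
proof (rule finite_subset)
  show "vertices D \<subseteq> Pow (Pow (ground D))"
    by (auto simp: vertices_def)
qed simp

lemma vertex_of_subset:
  assumes "a \<subseteq> ground D" "card a \<le> D"
  shows "{a, ground D - a} \<in> vertices D" "small {a, ground D - a} = a"
    "large {a, ground D - a} = ground D - a"
proof -
  show "{a, ground D - a} \<in> vertices D"
    using assms(1) by (auto simp: vertices_def)
  have "card (ground D - a) = 2 * D + 1 - card a"
    using assms(1) by (simp add: card_Diff_subset finite_subset)
  then have "card a < card (ground D - a)"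
    using assms(2) by simp
  then show "small {a, ground D - a} = a" "large {a, ground D - a} = ground D - a"
    by (simp_all add: small_large_eq)
qed

lemma vertex_cases:
  assumes "x \<in> vertices D"
  obtains a where "a \<subseteq> ground D" "card a \<le> D" "x = {a, ground D - a}"
proof -
  obtain u u' where x: "x = {u, u'}"
    using assms by (auto simp: vertices_def)
  note u = vertices_pair[OF assms[unfolded x]]
  have fin: "finite u"
    using u(1) by (rule finite_subset) simp
  have card: "card u' = 2 * D + 1 - card u"
    using u(1,2) fin by (simp add: card_Diff_subset)
  show thesis
  proof (cases "card u \<le> D")
    case True
    with that[of u] u x show thesis by simp
  next
    case False
    have "ground D - u' = u"
      using u(1,2) by auto
    with False that[of u'] u x card show thesis by (auto simp: insert_commute)
  qed
qed

lemma small_vertex: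
  assumes "x \<in> vertices D"
  shows "small x \<subseteq> ground D" "card (small x) \<le> D" "{small x, ground D - small x} = x"
    "large x = ground D - small x" "finite (small x)"
proof -
  obtain a where a: "a \<subseteq> ground D" "card a \<le> D" "x = {a, ground D - a}"
    using assms by (rule vertex_cases)
  with vertex_of_subset[OF a(1,2)]
  show "small x \<subseteq> ground D" "card (small x) \<le> D" "{small x, ground D - small x} = x"
    "large x = ground D - small x" "finite (small x)"
    by (auto intro: finite_subset)
qed

lemma small_inj:
  assumes "x \<in> vertices D" "y \<in> vertices D"
  shows "small x = small y \<longleftrightarrow> x = y"
  using small_vertex(3)[OF assms(1)] small_vertex(3)[OF assms(2)] by metis

text \<open>If the intersection of two finite sets has the size of each of them, it equals both. So
  equality of two vertices can be read off from three cardinalities, which is what puts the identity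
  and the diagonal generators among the matrices constant on orbits.\<close>

lemma vertex_eq_iff_card:
  assumes "x \<in> vertices D" "y \<in> vertices D"
  shows "x = y \<longleftrightarrow> card (small x \<inter> small y) = card (small x) \<and>
    card (small x \<inter> small y) = card (small y)"
proof -
  note fin = small_vertex(5)[OF assms(1)] small_vertex(5)[OF assms(2)]
  have "small x = small y" if "card (small x \<inter> small y) = card (small x)"
    "card (small x \<inter> small y) = card (small y)"
    using card_subset_eq[OF fin(1) Int_lower1 that(1)] card_subset_eq[OF fin(2) Int_lower2 that(2)]
    by simp
  then show ?thesis
    using small_inj[OF assms] by auto
qed

section \<open>Distances in terms of smaller parts\<close>

lemma card_sym_diff:
  assumes "finite a" "finite b"
  shows "card (sym_diff a b) + 2 * card (a \<inter> b) = card a + card b"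
proof -
  have "card (sym_diff a b) = card (a - b) + card (b - a)"
    using assms by (intro card_Un_disjoint) auto
  moreover have "card a = card (a - b) + card (a \<inter> b)"
    using assms card_Int_Diff[of a b] by simp
  moreover have "card b = card (b - a) + card (a \<inter> b)"
    using assms card_Int_Diff[of b a] by (simp add: Int_commute)
  ultimately show ?thesis by simp
qed

text \<open>Exchanging the two parts of \<open>y\<close> complements the symmetric difference in the
  ground set. The distance is therefore a function of the single number
  \<open>card (sym_diff (small x) (small y))\<close>.\<close>

lemma fc_dist_vertices:
  assumes "x \<in> vertices D" "y \<in> vertices D"
  shows "fc_dist x y = min (card (sym_diff (small x) (small y)))
    (2 * D + 1 - card (sym_diff (small x) (small y)))"
proof -
  note x = small_vertex[OF assms(1)] and y = small_vertex[OF assms(2)]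
  have sub: "sym_diff (small x) (small y) \<subseteq> ground D"
    using x(1) y(1) by auto
  have "sym_diff (small x) (large y) = ground D - sym_diff (small x) (small y)"
    using x(1) y(1) by (auto simp: y(4))
  then have "card (sym_diff (small x) (large y)) = 2 * D + 1 - card (sym_diff (small x) (small y))"
    using card_Diff_subset[OF finite_subset[OF sub finite_ground] sub] by simp
  then show ?thesis
    by (simp add: fc_dist_def)
qed

lemma base_vertex_in: "base_vertex D \<in> vertices D"
  and small_base_vertex: "small (base_vertex D) = {}"
  using vertex_of_subset[of "{}" D] by (simp_all add: base_vertex_def)

text \<open>The smaller part of the base vertex is empty, and \<open>small x\<close> has at most
  \<open>D\<close> elements, so the minimum is attained by its size. Hence
  \<open>dual_idem D k\<close> projects onto the vertices with smaller part of size
  \<open>k\<close>.\<close>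

lemma fc_dist_base_vertex:
  assumes "x \<in> vertices D"
  shows "fc_dist (base_vertex D) x = card (small x)"
  using small_vertex(2)[OF assms]
  by (simp add: fc_dist_vertices[OF base_vertex_in assms] small_base_vertex)

section \<open>Types of pairs of vertices\<close>

definition pair_type :: "vertex \<Rightarrow> vertex \<Rightarrow> nat \<times> nat \<times> nat" where
  "pair_type x y = (card (small x), card (small y), card (small x \<inter> small y))"

lemma M_mat_eq:
  "M_mat D p x y = (if x \<in> vertices D \<and> y \<in> vertices D \<and> pair_type x y = p then 1 else 0)"
  by (cases p) (simp add: M_mat_def pair_type_def)

lemma pair_type_in_index_set:
  assumes "x \<in> vertices D" "y \<in> vertices D"
  shows "pair_type x y \<in> index_set D"
proof -
  note x = small_vertex[OF assms(1)] and y = small_vertex[OF assms(2)]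
  have "card (small x \<inter> small y) \<le> card (small x)" "card (small x \<inter> small y) \<le> card (small y)"
    using x(5) y(5) by (auto intro: card_mono)
  with x(2) y(2) show ?thesis
    by (simp add: index_set_def pair_type_def)
qed

text \<open>This makes every \<open>M_mat D p\<close> with \<open>p\<close> in the index set
  nonzero, which the basis property rests on.\<close>

lemma ex_pair_type:
  assumes "p \<in> index_set D"
  obtains x y where "x \<in> vertices D" "y \<in> vertices D" "pair_type x y = p"
proof -
  obtain i j t where p: "p = (i, j, t)" and le: "t \<le> i" "t \<le> j" "i \<le> D" "j \<le> D" "i + j - t \<le> 2 * D"
    using assms by (auto simp: index_set_def)
  \<comment> \<open>Two intervals overlapping in the last \<open>t\<close> elements of the first;
    their union is {1..i + j - t}, which fits into the ground set.\<close>
  define a where "a = {1..i}"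
  define b where "b = {i - t + 1..i + j - t}"
  have "a \<inter> b = {i - t + 1..i}"
    using le by (auto simp: a_def b_def)
  then have card: "card a = i" "card b = j" "card (a \<inter> b) = t"
    using le by (simp_all add: a_def b_def)
  have a: "a \<subseteq> ground D" "card a \<le> D" and b: "b \<subseteq> ground D" "card b \<le> D"
    using le card by (auto simp: a_def b_def ground_def)
  show thesis
    using that vertex_of_subset[OF a] vertex_of_subset[OF b] card
    by (simp add: p pair_type_def)
qed

lemma finite_index_set [simp]: "finite (index_set D)"
  by (rule finite_subset[of _ "{..D} \<times> {..D} \<times> {..D}"]) (auto simp: index_set_def)

section \<open>The action of permutations of the ground set\<close>

text \<open>Two subsets cut \<open>G\<close> into four regions. The hypotheses force corresponding
  regions to have equal size, and a bijection is built one region at a time. Thus equal types mean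
  equal orbits.\<close>

lemma ex_bij_betw_two_subsets:
  assumes fin: "finite G" and sub: "A \<subseteq> G" "B \<subseteq> G" "A' \<subseteq> G" "B' \<subseteq> G"
    and card: "card A = card A'" "card B = card B'" "card (A \<inter> B) = card (A' \<inter> B')"
  shows "\<exists>\<pi>. bij_betw \<pi> G G \<and> \<pi> ` A = A' \<and> \<pi> ` B = B'"
proof -
  have extend: "\<exists>h. bij_betw h (P \<union> Q) (P' \<union> Q') \<and> (\<forall>x\<in>P. h x = f x)"
    if f: "bij_betw f P P'" and "P \<inter> Q = {}" "P' \<inter> Q' = {}" "finite Q" "finite Q'"
      "card Q = card Q'" for f and P P' Q Q' :: "'a set"
  proof -
    obtain g where g: "bij_betw g Q Q'"
      using finite_same_card_bij \<open>finite Q\<close> \<open>finite Q'\<close> \<open>card Q = card Q'\<close> by blast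
    let ?h = "\<lambda>x. if x \<in> P then f x else g x"
    have "bij_betw ?h P P'"
      using f by (simp cong: bij_betw_cong)
    moreover have "bij_betw ?h Q Q'"
      using g \<open>P \<inter> Q = {}\<close> by (subst bij_betw_cong[where g = g]) auto
    ultimately have "bij_betw ?h (P \<union> Q) (P' \<union> Q')"
      using \<open>P' \<inter> Q' = {}\<close> by (rule bij_betw_combine)
    then show ?thesis
      by (intro exI[of _ ?h]) simp
  qed
  have fins: "finite A" "finite B" "finite A'" "finite B'"
    using sub fin finite_subset by blast+
  obtain f where f: "bij_betw f (A \<inter> B) (A' \<inter> B')"
    using finite_same_card_bij card(3) fins by blast
  have "card (A - B) = card (A' - B')" "card (B - A) = card (B' - A')"
    using card card_Int_Diff[OF fins(1), of B] card_Int_Diff[OF fins(3), of B']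
      card_Int_Diff[OF fins(2), of A] card_Int_Diff[OF fins(4), of A']
    by (simp_all add: Int_commute)
  note cards = this
  obtain g where g: "bij_betw g (A \<inter> B \<union> (A - B)) (A' \<inter> B' \<union> (A' - B'))" "\<forall>x\<in>A \<inter> B. g x = f x"
    using extend[OF f, of "A - B" "A' - B'"] fins cards by auto
  then have gA: "bij_betw g A A'" by (simp add: Int_Diff_Un)
  obtain h where h: "bij_betw h (A \<union> (B - A)) (A' \<union> (B' - A'))" "\<forall>x\<in>A. h x = g x"
    using extend[OF gA, of "B - A" "B' - A'"] fins cards by auto
  then have hAB: "bij_betw h (A \<union> B) (A' \<union> B')" by simp
  \<comment> \<open>The bijection between the unions yields the equality of sizes for the last
    region, the outside of both sets.\<close>
  have "card (A \<union> B) = card (A' \<union> B')"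
    using bij_betw_same_card[OF hAB] .
  then have "card (G - (A \<union> B)) = card (G - (A' \<union> B'))"
    using sub fins by (simp add: card_Diff_subset)
  then obtain \<pi> where \<pi>: "bij_betw \<pi> (A \<union> B \<union> (G - (A \<union> B))) (A' \<union> B' \<union> (G - (A' \<union> B')))"
    "\<forall>x\<in>A \<union> B. \<pi> x = h x"
    using extend[OF hAB, of "G - (A \<union> B)" "G - (A' \<union> B')"] fin by auto
  have "A \<union> B \<union> (G - (A \<union> B)) = G" "A' \<union> B' \<union> (G - (A' \<union> B')) = G"
    using sub by auto
  with \<pi>(1) have bij: "bij_betw \<pi> G G" by simp
  have imA: "\<pi> ` A = A'"
    using gA h(2) \<pi>(2) by (auto simp: bij_betw_def cong: image_cong)
  have imAB: "\<pi> ` (A \<union> B) = A' \<union> B'"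
    using hAB image_cong[OF refl, of "A \<union> B" \<pi> h] \<pi>(2) by (simp add: bij_betw_def)
  have imI: "\<pi> ` (A \<inter> B) = A' \<inter> B'"
    using f image_cong[OF refl, of "A \<inter> B" \<pi> f] g(2) h(2) \<pi>(2) by (simp add: bij_betw_def)
  \<comment> \<open>The images of \<open>A \<union> B\<close>, \<open>A\<close> and
    \<open>A \<inter> B\<close> are known, and an injective map commutes with set differences, so
    writing \<open>B\<close> in terms of these three gives its image.\<close>
  have "B = (A \<union> B) - (A - A \<inter> B)" by auto
  then have "\<pi> ` B = \<pi> ` (A \<union> B) - (\<pi> ` A - \<pi> ` (A \<inter> B))"
    using bij sub inj_on_image_set_diff[of \<pi> G "A \<union> B" "A - A \<inter> B"]
      inj_on_image_set_diff[of \<pi> G A "A \<inter> B"]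
    by (auto simp: bij_betw_def)
  then have "\<pi> ` B = B'"
    unfolding imA imAB imI by auto
  with bij imA show ?thesis by blast
qed

text \<open>A permutation of the ground set preserves sizes and complements, so it sends parts of a
  vertex to parts and the smaller part to the smaller part.\<close>

lemma vertex_action:
  assumes "bij_betw \<pi> (ground D) (ground D)"
  shows "bij_betw ((`) ((`) \<pi>)) (vertices D) (vertices D)"
    and "z \<in> vertices D \<Longrightarrow> small ((`) \<pi> ` z) = \<pi> ` small z"
proof -
  have inj: "inj_on \<pi> (ground D)" and im: "\<pi> ` ground D = ground D"
    using assms by (auto simp: bij_betw_def)
  have act: "(`) \<pi> ` z \<in> vertices D \<and> small ((`) \<pi> ` z) = \<pi> ` small z" if "z \<in> vertices D" for z
  proof -
    note z = small_vertex[OF that]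
    have "\<pi> ` (ground D - small z) = ground D - \<pi> ` small z"
      using inj_on_image_set_diff[OF inj _ z(1), of "ground D"] im by auto
    then have eq: "(`) \<pi> ` z = {\<pi> ` small z, ground D - \<pi> ` small z}"
      by (subst z(3)[symmetric]) simp
    have "\<pi> ` small z \<subseteq> ground D" "card (\<pi> ` small z) \<le> D"
      using z(1,2,5) im card_image_le[of "small z" \<pi>] by auto
    then show ?thesis
      unfolding eq using vertex_of_subset by blast
  qed
  then show "z \<in> vertices D \<Longrightarrow> small ((`) \<pi> ` z) = \<pi> ` small z" by blast
  have "inj_on ((`) ((`) \<pi>)) (vertices D)"
  proof (rule inj_onI)
    fix y z assume yz: "y \<in> vertices D" "z \<in> vertices D" "(`) \<pi> ` y = (`) \<pi> ` z"
    then have "\<pi> ` small y = \<pi> ` small z"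
      using act by metis
    then have "small y = small z"
      using inj_on_image_eq_iff[OF inj small_vertex(1)[OF yz(1)] small_vertex(1)[OF yz(2)]] by simp
    then show "y = z"
      using small_inj[OF yz(1,2)] by simp
  qed
  \<comment> \<open>An injective map of the finite set of vertices into itself is onto.\<close>
  moreover have "(`) ((`) \<pi>) ` vertices D = vertices D"
    using act by (intro endo_inj_surj calculation) auto
  ultimately show "bij_betw ((`) ((`) \<pi>)) (vertices D) (vertices D)"
    by (simp add: bij_betw_def)
qed

section \<open>The algebra of matrices constant on types\<close>

text \<open>This is the centralizer algebra of the symmetric group acting on the vertices, with its
  orbits on pairs described by their numerical invariants.\<close>

definition type_constant :: "nat \<Rightarrow> matrix set" where
  "type_constant D = {P \<in> matrices D. \<forall>x\<in>vertices D. \<forall>y\<in>vertices D. \<forall>x'\<in>vertices D. \<forall>y'\<in>vertices D.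
     pair_type x y = pair_type x' y' \<longrightarrow> P x y = P x' y'}"

lemma type_constant_subset_matrices: "type_constant D \<subseteq> matrices D"
  unfolding type_constant_def by (rule Collect_restrict)

lemma type_constantI:
  assumes "P \<in> matrices D"
    and "\<And>x y x' y'. \<lbrakk>x \<in> vertices D; y \<in> vertices D; x' \<in> vertices D; y' \<in> vertices D;
      pair_type x y = pair_type x' y'\<rbrakk> \<Longrightarrow> P x y = P x' y'"
  shows "P \<in> type_constant D"
  unfolding type_constant_def by (intro CollectI conjI ballI impI) (fact assms(1), rule assms(2))

lemma type_constantD:
  assumes "P \<in> type_constant D" "x \<in> vertices D" "y \<in> vertices D" "x' \<in> vertices D"
    "y' \<in> vertices D" "pair_type x y = pair_type x' y'"
  shows "P x y = P x' y'"
proof -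
  have "\<forall>x\<in>vertices D. \<forall>y\<in>vertices D. \<forall>x'\<in>vertices D. \<forall>y'\<in>vertices D.
      pair_type x y = pair_type x' y' \<longrightarrow> P x y = P x' y'"
    using assms(1) unfolding type_constant_def mem_Collect_eq by (rule conjunct2)
  from this[THEN bspec, OF assms(2), THEN bspec, OF assms(3), THEN bspec, OF assms(4),
      THEN bspec, OF assms(5)]
  show ?thesis
    using assms(6) by (rule mp)
qed

lemma M_mat_type_constant: "M_mat D p \<in> type_constant D"
  by (rule type_constantI) (auto simp: matrices_def M_mat_eq)

text \<open>The type determines the size of the symmetric difference by
  \<open>card_sym_diff\<close>, and that size determines the distance.\<close>

lemma dist_mat_type_constant: "dist_mat D k \<in> type_constant D"
proof (rule type_constantI)
  show "dist_mat D k \<in> matrices D"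
    by (auto simp: matrices_def dist_mat_def)
next
  fix x y x' y'
  assume v: "x \<in> vertices D" "y \<in> vertices D" "x' \<in> vertices D" "y' \<in> vertices D"
    and "pair_type x y = pair_type x' y'"
  then have "card (sym_diff (small x) (small y)) = card (sym_diff (small x') (small y'))"
    using card_sym_diff[of "small x" "small y"] card_sym_diff[of "small x'" "small y'"]
      small_vertex(5)[OF v(1)] small_vertex(5)[OF v(2)]
      small_vertex(5)[OF v(3)] small_vertex(5)[OF v(4)]
    by (simp add: pair_type_def)
  then show "dist_mat D k x y = dist_mat D k x' y'"
    using v by (simp add: dist_mat_def fc_dist_vertices)
qed

lemma dual_idem_type_constant: "dual_idem D k \<in> type_constant D"
proof (rule type_constantI)
  show "dual_idem D k \<in> matrices D"
    by (auto simp: matrices_def dual_idem_def)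
next
  fix x y x' y'
  assume v: "x \<in> vertices D" "y \<in> vertices D" "x' \<in> vertices D" "y' \<in> vertices D"
    and t: "pair_type x y = pair_type x' y'"
  have "y = x \<longleftrightarrow> y' = x'"
    using vertex_eq_iff_card[OF v(1,2)] vertex_eq_iff_card[OF v(3,4)] t
    by (auto simp: pair_type_def)
  then show "dual_idem D k x y = dual_idem D k x' y'"
    using v t by (simp add: dual_idem_def fc_dist_base_vertex pair_type_def)
qed

lemma mat_one_type_constant: "mat_one D \<in> type_constant D"
proof (rule type_constantI)
  show "mat_one D \<in> matrices D"
    by (auto simp: matrices_def mat_one_def)
next
  fix x y x' y'
  assume v: "x \<in> vertices D" "y \<in> vertices D" "x' \<in> vertices D" "y' \<in> vertices D"
    and t: "pair_type x y = pair_type x' y'"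
  have "y = x \<longleftrightarrow> y' = x'"
    using vertex_eq_iff_card[OF v(1,2)] vertex_eq_iff_card[OF v(3,4)] t
    by (auto simp: pair_type_def)
  then show "mat_one D x y = mat_one D x' y'"
    using v by (simp add: mat_one_def)
qed

text \<open>A permutation carrying \<open>(x, y)\<close> to \<open>(x', y')\<close> also permutes
  the intermediate vertices \<open>z\<close> and preserves types. Reindexing the sum over
  \<open>z\<close> along it turns one entry of the product into the other.\<close>

lemma mat_mult_type_constant:
  assumes P: "P \<in> type_constant D" and Q: "Q \<in> type_constant D"
  shows "mat_mult D P Q \<in> type_constant D"
proof (rule type_constantI)
  show "mat_mult D P Q \<in> matrices D"
    using P Q type_constant_subset_matrices subalgebra_matrices[of D] unfolding subalgebra_def by blast
next
  fix x y x' y'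
  assume v: "x \<in> vertices D" "y \<in> vertices D" "x' \<in> vertices D" "y' \<in> vertices D"
    and t: "pair_type x y = pair_type x' y'"
  obtain \<pi> where \<pi>: "bij_betw \<pi> (ground D) (ground D)"
    "\<pi> ` small x = small x'" "\<pi> ` small y = small y'"
    using ex_bij_betw_two_subsets[OF finite_ground[of D] v[THEN small_vertex(1)]] t
    by (auto simp: pair_type_def)
  note act = vertex_action[OF \<pi>(1)]
  have inj: "inj_on \<pi> (ground D)"
    using \<pi>(1) by (simp add: bij_betw_def)
  have card: "card (\<pi> ` a \<inter> \<pi> ` b) = card (a \<inter> b)" "card (\<pi> ` a) = card a"
    if "a \<subseteq> ground D" "b \<subseteq> ground D" for a b
  proof -
    have "\<pi> ` a \<inter> \<pi> ` b = \<pi> ` (a \<inter> b)"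
      using inj_on_image_Int[OF inj that] by simp
    then show "card (\<pi> ` a \<inter> \<pi> ` b) = card (a \<inter> b)"
      using that inj by (simp add: card_image inj_on_subset le_infI1)
    show "card (\<pi> ` a) = card a"
      using that inj by (simp add: card_image inj_on_subset)
  qed
  have "P x z * Q z y = P x' ((`) \<pi> ` z) * Q ((`) \<pi> ` z) y'" if z: "z \<in> vertices D" for z
  proof -
    have z': "(`) \<pi> ` z \<in> vertices D"
      using act(1) z by (auto simp: bij_betw_def)
    note sub = small_vertex(1)[OF z] small_vertex(1)[OF v(1)] small_vertex(1)[OF v(2)]
    have "pair_type x z = pair_type x' ((`) \<pi> ` z)" "pair_type z y = pair_type ((`) \<pi> ` z) y'"
      using sub by (simp_all add: pair_type_def act(2)[OF z] \<pi>(2,3)[symmetric] card)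
    then show ?thesis
      using type_constantD[OF P v(1) z v(3) z'] type_constantD[OF Q z v(2) z' v(4)] by simp
  qed
  then have "mat_mult D P Q x y = (\<Sum>z\<in>vertices D. P x' ((`) \<pi> ` z) * Q ((`) \<pi> ` z) y')"
    by (simp add: mat_mult_def)
  also have "\<dots> = mat_mult D P Q x' y'"
    unfolding mat_mult_def by (rule sum.reindex_bij_betw[OF act(1)])
  finally show "mat_mult D P Q x y = mat_mult D P Q x' y'" .
qed

lemma subspace_type_constant: "mat_vs.subspace (type_constant D)"
proof -
  have "mat_vs.subspace (matrices D)"
    using subalgebra_matrices[of D] by (simp add: subalgebra_def)
  note sub = mat_vs.subspace_0[OF this] mat_vs.subspace_add[OF this] mat_vs.subspace_scale[OF this]
  show ?thesis
  proof (rule mat_vs.subspaceI)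
    show "0 \<in> type_constant D"
      using sub(1) by (intro type_constantI) simp_all
  next
    fix P Q assume PQ: "P \<in> type_constant D" "Q \<in> type_constant D"
    show "P + Q \<in> type_constant D"
    proof (rule type_constantI)
      show "P + Q \<in> matrices D"
        using PQ type_constant_subset_matrices by (intro sub(2)) blast+
    next
      fix x y x' y'
      assume "x \<in> vertices D" "y \<in> vertices D" "x' \<in> vertices D" "y' \<in> vertices D"
        "pair_type x y = pair_type x' y'"
      note eq = type_constantD[OF _ this]
      show "(P + Q) x y = (P + Q) x' y'"
        unfolding plus_fun_apply by (rule arg_cong2[OF eq[OF PQ(1)] eq[OF PQ(2)]])
    qed
  next
    fix c P assume P: "P \<in> type_constant D"
    show "mat_scale c P \<in> type_constant D"
    proof (rule type_constantI)
      show "mat_scale c P \<in> matrices D"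
        using P type_constant_subset_matrices by (intro sub(3)) blast
    next
      fix x y x' y'
      assume "x \<in> vertices D" "y \<in> vertices D" "x' \<in> vertices D" "y' \<in> vertices D"
        "pair_type x y = pair_type x' y'"
      then show "mat_scale c P x y = mat_scale c P x' y'"
        unfolding mat_scale_def by (rule arg_cong[OF type_constantD[OF P]])
    qed
  qed
qed

lemma subalgebra_type_constant: "subalgebra D (type_constant D)"
  by (simp add: subalgebra_def type_constant_subset_matrices subspace_type_constant
      mat_one_type_constant mat_mult_type_constant)

section \<open>The span of the matrices and their independence\<close>

lemma sum_mat_scale_apply:
  "(\<Sum>i\<in>I. mat_scale (c i) (F i)) x y = (\<Sum>i\<in>I. c i * F i x y)"
  by (induction I rule: infinite_finite_induct) (simp_all add: mat_scale_def)

lemma A_prime_eq_type_constant: "A_prime D = type_constant D"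
proof
  show "A_prime D \<subseteq> type_constant D"
    unfolding A_prime_def
    by (rule mat_vs.span_minimal) (auto intro: M_mat_type_constant subspace_type_constant)
next
  show "type_constant D \<subseteq> A_prime D"
  proof
    fix P assume P: "P \<in> type_constant D"
    \<comment> \<open>The coefficient of \<open>M_mat D p\<close> is the common value of
      \<open>P\<close> on pairs of type \<open>p\<close>; if there are no such pairs, any value will
      do.\<close>
    have "\<exists>c. \<forall>x\<in>vertices D. \<forall>y\<in>vertices D. pair_type x y = p \<longrightarrow> P x y = c" for p
    proof (cases "\<exists>x\<in>vertices D. \<exists>y\<in>vertices D. pair_type x y = p")
      case True
      then obtain x' y' where v': "x' \<in> vertices D" "y' \<in> vertices D" "pair_type x' y' = p"
        by blast
      have "P x y = P x' y'" if "x \<in> vertices D" "y \<in> vertices D" "pair_type x y = p" for x y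
        by (rule type_constantD[OF P that(1,2) v'(1,2)]) (simp add: that(3) v'(3))
      then show ?thesis by blast
    qed blast
    then obtain c where c: "\<And>x y. x \<in> vertices D \<Longrightarrow> y \<in> vertices D \<Longrightarrow> P x y = c (pair_type x y)"
      by metis
    have "P = (\<Sum>p\<in>index_set D. mat_scale (c p) (M_mat D p))"
    proof (intro ext)
      fix x y
      show "P x y = (\<Sum>p\<in>index_set D. mat_scale (c p) (M_mat D p)) x y"
      proof (cases "x \<in> vertices D \<and> y \<in> vertices D")
        case True
        then have "(\<Sum>p\<in>index_set D. c p * M_mat D p x y) =
          (\<Sum>p\<in>index_set D. if pair_type x y = p then c p else 0)"
          by (intro sum.cong) (auto simp: M_mat_eq)
        also have "\<dots> = c (pair_type x y)"
          using True pair_type_in_index_set by simp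
        finally show ?thesis
          using True c by (simp add: sum_mat_scale_apply)
      next
        case False
        then have "P x y = 0"
          using P type_constant_subset_matrices unfolding matrices_def by blast
        with False show ?thesis
          by (auto simp: sum_mat_scale_apply M_mat_eq)
      qed
    qed
    also have "\<dots> \<in> A_prime D"
      unfolding A_prime_def
      by (intro mat_vs.span_sum mat_vs.span_scale mat_vs.span_base imageI)
    finally show "P \<in> A_prime D" .
  qed
qed

lemma basis_family_M_mat: "basis_family (M_mat D) (index_set D) (A_prime D)"
proof -
  have "inj_on (M_mat D) (index_set D)"
  proof (rule inj_onI)
    fix p q assume "p \<in> index_set D" and eq: "M_mat D p = M_mat D q"
    then obtain x y where "x \<in> vertices D" "y \<in> vertices D" "pair_type x y = p"
      using ex_pair_type by blast
    with fun_cong[OF fun_cong[OF eq], of x y] show "p = q"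
      by (simp add: M_mat_eq split: if_splits)
  qed
  moreover have "mat_vs.independent (M_mat D ` index_set D)"
  proof (rule mat_vs.independent_if_scalars_zero)
    fix f N
    assume zero: "(\<Sum>Q\<in>M_mat D ` index_set D. mat_scale (f Q) Q) = 0"
      and "N \<in> M_mat D ` index_set D"
    then obtain p where p: "p \<in> index_set D" "N = M_mat D p" by blast
    obtain x y where xy: "x \<in> vertices D" "y \<in> vertices D" "pair_type x y = p"
      using ex_pair_type p(1) by blast
    have "0 = (\<Sum>Q\<in>M_mat D ` index_set D. f Q * Q x y)"
      using fun_cong[OF fun_cong[OF zero], of x y] by (simp add: sum_mat_scale_apply)
    \<comment> \<open>The matrices have pairwise disjoint supports: at an entry of type
      \<open>p\<close> only \<open>M_mat D p\<close> is nonzero, so this entry isolates its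
      coefficient.\<close>
    also have "\<dots> = (\<Sum>Q\<in>M_mat D ` index_set D. if Q = N then f Q else 0)"
      using xy p by (intro sum.cong) (auto simp: M_mat_eq split: if_splits)
    also have "\<dots> = f N"
      using p by simp
    finally show "f N = 0" by simp
  qed simp
  ultimately show ?thesis
    by (simp add: basis_family_def A_prime_def)
qed

section \<open>Recovering the matrices from the generators\<close>

text \<open>The two outer factors are diagonal 0-1 matrices, so the product cuts out the block of
  \<open>P\<close> with row level \<open>i\<close> and column level \<open>j\<close>.\<close>

lemma dual_idem_sandwich:
  assumes "x \<in> vertices D" "y \<in> vertices D"
  shows "mat_mult D (mat_mult D (dual_idem D i) P) (dual_idem D j) x y =
    (if card (small x) = i \<and> card (small y) = j then P x y else 0)"
proof -
  have left: "mat_mult D (dual_idem D i) P x z = (if card (small x) = i then P x z else 0)" for z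
  proof -
    have "mat_mult D (dual_idem D i) P x z =
      (\<Sum>w\<in>vertices D. if w = x then (if card (small x) = i then P x z else 0) else 0)"
      unfolding mat_mult_def using assms(1)
      by (intro sum.cong) (auto simp: dual_idem_def fc_dist_base_vertex)
    then show ?thesis
      using assms(1) by simp
  qed
  have "mat_mult D (mat_mult D (dual_idem D i) P) (dual_idem D j) x y =
    (\<Sum>w\<in>vertices D. if w = y then
      (if card (small x) = i \<and> card (small y) = j then P x y else 0) else 0)"
    unfolding mat_mult_def[of D "mat_mult D (dual_idem D i) P"] left using assms(2)
    by (intro sum.cong) (auto simp: dual_idem_def fc_dist_base_vertex)
  then show ?thesis
    using assms(2) by simp
qed

lemma M_mat_eq_product:
  assumes "(i, j, t) \<in> index_set D"
  defines "k \<equiv> min (i + j - 2 * t) (2 * D + 1 - (i + j - 2 * t))"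
  shows "M_mat D (i, j, t) = mat_mult D (mat_mult D (dual_idem D i) (dist_mat D k)) (dual_idem D j)"
    (is "_ = ?R")
proof (intro ext)
  fix x y
  have le: "t \<le> i" "t \<le> j" "i \<le> D" "j \<le> D"
    using assms(1) by (auto simp: index_set_def)
  \<comment> \<open>Needed for the entries outside the vertex set, where both sides vanish.\<close>
  have R: "?R \<in> matrices D"
    using subalgebra_type_constant[of D] dist_mat_type_constant dual_idem_type_constant
    by (auto simp: subalgebra_def)
  show "M_mat D (i, j, t) x y = ?R x y"
  proof (cases "x \<in> vertices D \<and> y \<in> vertices D")
    case True
    then have v: "x \<in> vertices D" "y \<in> vertices D" by auto
    have "fc_dist x y = k \<longleftrightarrow> card (small x \<inter> small y) = t"
      if ij: "card (small x) = i" "card (small y) = j"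
    proof -
      define d where "d = card (sym_diff (small x) (small y))"
      have sd: "d + 2 * card (small x \<inter> small y) = i + j"
        using card_sym_diff small_vertex(5) v ij unfolding d_def by metis
      have "fc_dist x y = min d (2 * D + 1 - d)"
        using fc_dist_vertices[OF v] by (simp add: d_def)
      moreover have "d = i + j - 2 * t" if "min d (2 * D + 1 - d) = k"
      proof (rule ccontr)
        \<comment> \<open>Equal minima leave only the case where \<open>d\<close> and
          \<open>i + j - 2 * t\<close> are complementary in \<open>2 * D + 1\<close>. Both have the
          parity of \<open>i + j\<close>, so their sum is even, a contradiction.\<close>
        assume "d \<noteq> i + j - 2 * t"
        with that have "d + (i + j - 2 * t) = 2 * D + 1"
          using sd le by (auto simp: k_def min_def split: if_splits)
        then have "2 * (i + j) = 2 * (D + t + card (small x \<inter> small y)) + 1"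
          using sd le by (simp add: diff_mult_distrib2)
        then show False by presburger
      qed
      then have "min d (2 * D + 1 - d) = k \<longleftrightarrow> d = i + j - 2 * t"
        by (auto simp: k_def)
      ultimately show ?thesis
        using sd le by auto
    qed
    then show ?thesis
      unfolding dual_idem_sandwich[OF v] using v
      by (auto simp: M_mat_eq pair_type_def dist_mat_def)
  next
    case False
    then show ?thesis
      using R by (auto simp: M_mat_eq matrices_def)
  qed
qed

theorem theorem3p13:
  fixes D :: nat
  assumes "D \<ge> 3"
  shows "terwilliger_algebra D = A_prime D \<and> basis_family (M_mat D) (index_set D) (A_prime D)"
proof
  let ?G = "dist_mat D ` {0..D} \<union> dual_idem D ` {0..D}"
  have "M_mat D p \<in> B" if p: "p \<in> index_set D" and B: "subalgebra D B" "?G \<subseteq> B" for p B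
  proof -
    obtain i j t where ijt: "p = (i, j, t)" by (cases p)
    define k where "k = min (i + j - 2 * t) (2 * D + 1 - (i + j - 2 * t))"
    \<comment> \<open>The two arguments of the minimum add up to \<open>2 * D + 1\<close>, so the
      smaller is at most \<open>D\<close> and \<open>dist_mat D k\<close> is one of the
      generators.\<close>
    have "i \<le> D" "j \<le> D" "k \<le> D"
      using p by (auto simp: ijt index_set_def k_def)
    then have "dual_idem D i \<in> B" "dist_mat D k \<in> B" "dual_idem D j \<in> B"
      using B(2) by auto
    then show ?thesis
      using B(1) M_mat_eq_product[OF p[unfolded ijt]] by (simp add: subalgebra_def ijt k_def)
  qed
  \<comment> \<open>The hull is the intersection of all subalgebras containing the generators; each
    is a subspace, so it contains the span once it contains the spanning matrices.\<close>
  then have "A_prime D \<subseteq> terwilliger_algebra D"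
    unfolding terwilliger_algebra_def hull_def A_prime_def
    by (intro Inter_greatest mat_vs.span_minimal) (auto simp: subalgebra_def)
  moreover have "terwilliger_algebra D \<subseteq> A_prime D"
    unfolding terwilliger_algebra_def A_prime_eq_type_constant
    by (rule hull_minimal)
      (auto intro: dist_mat_type_constant dual_idem_type_constant subalgebra_type_constant)
  ultimately show "terwilliger_algebra D = A_prime D" by simp
  show "basis_family (M_mat D) (index_set D) (A_prime D)"
    by (rule basis_family_M_mat)
qed

end
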